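(* Let $\mathcal G=\{G_1\xleftarrow{\varphi_1}G_2\xleftarrow{\varphi_2}\cdots\}$ be a graph cover, $G_i=(V_i,E_i)$, with associated inverse limit system $(V_{\mathcal G},E_{\mathcal G})$. Then the system $(V_{\mathcal G},E_{\mathcal G})$ has the shadowing property if and only if the inverse system of the orbit spaces (spaces of infinite walks) of the graphs $G_i$, $i\in\mathbb N$, with the bonding maps induced coordinatewise by the $\varphi_i$, satisfies the Mittag-Leffler condition.
   Context: A finite directed graph is $G=(V,E)$ with $V$ a finite set (discrete topology) and $E\subset V\times V$; it is always assumed that for each $u\in V$ there is $v\in V$ with $(u,v)\in E$. A graph homomorphism $\varphi:(V_1,E_1)\to(V_2,E_2)$ is a map $\varphi:V_1\to V_2$ with $(u,v)\in E_1\Rightarrow(\varphi(u),\varphi(v))\in E_2$. It is edge-surjective if $(\varphi\times\varphi)(E_1)=E_2$, and $+$directional if $(u,v),(u,v')\in E_1$ implies $\varphi(v)=\varphi(v')$. A graph cover is a sequence $G_1\xleftarrow{\varphi_1}G_2\xleftarrow{\varphi_2}\cdots$ of $+$directional edge-surjective graph homomorphisms $\varphi_i:G_{i+1}\to G_i$, together with $V_{\mathcal G}=\{(x_i)\in\prod_iV_i:x_i=\varphi_i(x_{i+1})\ \forall i\}$ (topology inherited from the product), $E_{\mathcal G}=\{(\boldsymbol x,\boldsymbol y)\in V_{\mathcal G}\times V_{\mathcal G}:(x_i,y_i)\in E_i\ \forall i\}$, and the dynamical action $\boldsymbol x\mapsto E_{\mathcal G}(\boldsymbol x)=\{\boldsymbol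 y:(\boldsymbol x,\boldsymbol y)\in E_{\mathcal G}\}$. The space of infinite walks of $G=(V,E)$ is $\{(u_j)_{j\ge0}\in V^{\omega}:(u_j,u_{j+1})\in E\ \forall j\ge0\}$; $\varphi_i$ induces the map $(u_j)_j\mapsto(\varphi_i(u_j))_j$ from walks of $G_{i+1}$ to walks of $G_i$. An inverse sequence of spaces satisfies the Mittag-Leffler condition if for every $i$ there is $k\ge i$ such that for all $m\ge k$ the image of the $m$-th space in the $i$-th space equals the image of the $k$-th space. Shadowing property for $F=E_{\mathcal G}(\cdot)$ on $X=V_{\mathcal G}$: for every finite open cover $\mathcal U$ of $X$ there is a finite open cover $\mathcal V$ of $X$ such that for every sequence $(x_i)_{i\ge0}$ in $X$ for which, for each $i$, some $W\in\mathcal V$ satisfies $F(x_i)\cap W\neq\emptyset$ and $x_{i+1}\in W$, there is $(z_i)_{i\ge0}$ with $z_{i+1}\in F(z_i)$ for all $i$ and such that for each $i$ some $U\in\mathcal U$ contains both $x_i$ and $z_i$. *)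

theory Defs
  imports "HOL-Analysis.Analysis" "Graph_Theory.Pair_Digraph"
begin

text \<open>
  A graph is a \<^typ>\<open>'a pair_pre_digraph\<close>; \<^const>\<open>pair_fin_digraph\<close> says that the vertex set is
  finite and that the arcs are pairs of vertices (loops are allowed).
\<close>

definition finite_graph :: "'a pair_pre_digraph \<Rightarrow> bool" where
  "finite_graph G \<longleftrightarrow> pair_fin_digraph G \<and> (\<forall>u\<in>pverts G. \<exists>v\<in>pverts G. (u, v) \<in> parcs G)"

definition graph_hom :: "'a pair_pre_digraph \<Rightarrow> 'b pair_pre_digraph \<Rightarrow> ('a \<Rightarrow> 'b) \<Rightarrow> bool" where
  "graph_hom G H \<phi> \<longleftrightarrow>
     \<phi> ` pverts G \<subseteq> pverts H \<and> (\<forall>u v. (u, v) \<in> parcs G \<longrightarrow> (\<phi> u, \<phi> v) \<in> parcs H)"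

definition edge_surjective :: "'a pair_pre_digraph \<Rightarrow> 'b pair_pre_digraph \<Rightarrow> ('a \<Rightarrow> 'b) \<Rightarrow> bool" where
  "edge_surjective G H \<phi> \<longleftrightarrow> map_prod \<phi> \<phi> ` parcs G = parcs H"

definition plus_directional :: "'a pair_pre_digraph \<Rightarrow> ('a \<Rightarrow> 'b) \<Rightarrow> bool" where
  "plus_directional G \<phi> \<longleftrightarrow>
     (\<forall>u v v'. (u, v) \<in> parcs G \<longrightarrow> (u, v') \<in> parcs G \<longrightarrow> \<phi> v = \<phi> v')"

text \<open>
  Sequences of graphs are indexed from 0 instead of 1. The vertices of all the graphs are taken
  from one ambient type; the vertex sets need neither be disjoint nor be related to each other.
\<close>

definition graph_cover :: "(nat \<Rightarrow> 'a pair_pre_digraph) \<Rightarrow> (nat \<Rightarrow> 'a \<Rightarrow> 'a) \<Rightarrow> bool" where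
  "graph_cover G \<phi> \<longleftrightarrow>
     (\<forall>i. finite_graph (G i)) \<and>
     (\<forall>i. graph_hom (G (Suc i)) (G i) (\<phi> i) \<and>
          edge_surjective (G (Suc i)) (G i) (\<phi> i) \<and>
          plus_directional (G (Suc i)) (\<phi> i))"

definition limit_verts ::
    "(nat \<Rightarrow> 'a pair_pre_digraph) \<Rightarrow> (nat \<Rightarrow> 'a \<Rightarrow> 'a) \<Rightarrow> (nat \<Rightarrow> 'a) set" where
  "limit_verts G \<phi> = {x \<in> (\<Pi> i\<in>UNIV. pverts (G i)). \<forall>i. x i = \<phi> i (x (Suc i))}"

definition limit_topology ::
    "(nat \<Rightarrow> 'a pair_pre_digraph) \<Rightarrow> (nat \<Rightarrow> 'a \<Rightarrow> 'a) \<Rightarrow> (nat \<Rightarrow> 'a) topology" where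
  "limit_topology G \<phi> =
     subtopology (product_topology (\<lambda>i. discrete_topology (pverts (G i))) UNIV) (limit_verts G \<phi>)"

definition limit_edges ::
    "(nat \<Rightarrow> 'a pair_pre_digraph) \<Rightarrow> (nat \<Rightarrow> 'a \<Rightarrow> 'a) \<Rightarrow> ((nat \<Rightarrow> 'a) \<times> (nat \<Rightarrow> 'a)) set" where
  "limit_edges G \<phi> =
     {(x, y) \<in> limit_verts G \<phi> \<times> limit_verts G \<phi>. \<forall>i. (x i, y i) \<in> parcs (G i)}"

definition limit_action ::
    "(nat \<Rightarrow> 'a pair_pre_digraph) \<Rightarrow> (nat \<Rightarrow> 'a \<Rightarrow> 'a) \<Rightarrow> (nat \<Rightarrow> 'a) \<Rightarrow> (nat \<Rightarrow> 'a) set" where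
  "limit_action G \<phi> x = limit_edges G \<phi> `` {x}"

definition finite_open_cover :: "'b topology \<Rightarrow> 'b set set \<Rightarrow> bool" where
  "finite_open_cover X \<U> \<longleftrightarrow> finite \<U> \<and> (\<forall>U\<in>\<U>. openin X U) \<and> \<Union>\<U> = topspace X"

definition pseudo_orbit :: "'b topology \<Rightarrow> ('b \<Rightarrow> 'b set) \<Rightarrow> 'b set set \<Rightarrow> (nat \<Rightarrow> 'b) \<Rightarrow> bool" where
  "pseudo_orbit X F \<V> x \<longleftrightarrow>
     (\<forall>i. x i \<in> topspace X) \<and> (\<forall>i. \<exists>W\<in>\<V>. F (x i) \<inter> W \<noteq> {} \<and> x (Suc i) \<in> W)"

definition shadowing_property :: "'b topology \<Rightarrow> ('b \<Rightarrow> 'b set) \<Rightarrow> bool" where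
  "shadowing_property X F \<longleftrightarrow>
     (\<forall>\<U>. finite_open_cover X \<U> \<longrightarrow>
       (\<exists>\<V>. finite_open_cover X \<V> \<and>
         (\<forall>x. pseudo_orbit X F \<V> x \<longrightarrow>
           (\<exists>z. (\<forall>i. z i \<in> topspace X) \<and> (\<forall>i. z (Suc i) \<in> F (z i)) \<and>
                (\<forall>i. \<exists>U\<in>\<U>. x i \<in> U \<and> z i \<in> U)))))"

definition infinite_walks :: "'a pair_pre_digraph \<Rightarrow> (nat \<Rightarrow> 'a) set" where
  "infinite_walks G = {u. (\<forall>j. u j \<in> pverts G) \<and> (\<forall>j. (u j, u (Suc j)) \<in> parcs G)}"

definition walk_map :: "('a \<Rightarrow> 'b) \<Rightarrow> (nat \<Rightarrow> 'a) \<Rightarrow> nat \<Rightarrow> 'b" where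
  "walk_map \<phi> u = (\<lambda>j. \<phi> (u j))"

text \<open>
  For an inverse sequence with bonding maps \<open>f i : X (i + 1) \<rightarrow> X i\<close>, the map \<open>bond f i k\<close> is the
  composite \<open>f i \<circ> f (i + 1) \<circ> \<dots> \<circ> f (i + k - 1)\<close> from \<open>X (i + k)\<close> to \<open>X i\<close>.
\<close>

primrec bond :: "(nat \<Rightarrow> 'b \<Rightarrow> 'b) \<Rightarrow> nat \<Rightarrow> nat \<Rightarrow> 'b \<Rightarrow> 'b" where
  "bond f i 0 = id"
| "bond f i (Suc k) = bond f i k \<circ> f (i + k)"

definition mittag_leffler :: "(nat \<Rightarrow> 'b set) \<Rightarrow> (nat \<Rightarrow> 'b \<Rightarrow> 'b) \<Rightarrow> bool" where
  "mittag_leffler X f \<longleftrightarrow>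
     (\<forall>i. \<exists>k\<ge>i. \<forall>m\<ge>k. bond f i (m - i) ` X m = bond f i (k - i) ` X k)"

end

theory Submission
  imports Defs
begin

text \<open>
  Because the bonding maps are \<open>+\<close>directional, \<^const>\<open>limit_action\<close> is single-valued, and the
  level-\<open>k\<close> coordinate of the image of \<open>x\<close> is determined by \<open>x (k + 1)\<close>. Hence a walk of
  \<open>G (k + 1)\<close>, lifted vertex by vertex to the limit, is a pseudo-orbit for the cover by level-\<open>k\<close>
  cylinders, and conversely such a pseudo-orbit projects to a walk of \<open>G k\<close>. Orbits of the limit
  system are the threads of the inverse sequence of walk spaces, and by compactness every open
  cover is refined by the cylinders of some level. So shadowing says that for every \<open>i\<close> there is a
  \<open>k\<close> such that walks of \<open>G i\<close> which lift to \<open>G k\<close> lift to a thread, and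
  for the inverse sequence of walk spaces this is the Mittag-Leffler condition.
\<close>

section \<open>Inverse sequences of sets\<close>

lemma bond_add: "bond f i (k + l) = bond f i k \<circ> bond f (i + k) l"
  by (induction l) (auto simp: fun_eq_iff add.assoc)

text \<open>The recursion of \<open>bond\<close> splits off the map farthest from level
  \<open>i\<close>. Splitting off the nearest one instead allows images in levels \<open>i\<close>
  and \<open>Suc i\<close> to be compared.\<close>

lemma bond_Suc': "bond f i (Suc k) x = f i (bond f (Suc i) k x)"
  using bond_add[of f i 1 k] by simp

lemma bond_thread:
  assumes "\<forall>j. x j = f j (x (Suc j))"
  shows "bond f i k (x (i + k)) = x i"
proof (induction k)
  case (Suc k)
  then show ?case
    by (simp add: assms[rule_format, of "i + k", symmetric])
qed simp

lemma bond_thread_le: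
  assumes "\<forall>j. x j = f j (x (Suc j))" "i \<le> k"
  shows "bond f i (k - i) (x k) = x i"
  using bond_thread[of x f i "k - i", OF assms(1)] assms(2) by simp

lemma bond_in:
  assumes "\<And>i. f i ` X (Suc i) \<subseteq> X i" "x \<in> X (i + k)"
  shows "bond f i k x \<in> X i"
  using assms(2)
proof (induction k arbitrary: x)
  case (Suc k)
  then show ?case using assms(1)[of "i + k"] by auto
qed simp

lemma bond_image_antimono:
  assumes "\<And>i. f i ` X (Suc i) \<subseteq> X i" "i \<le> k" "k \<le> m"
  shows "bond f i (m - i) ` X m \<subseteq> bond f i (k - i) ` X k"
proof -
  have "bond f i (m - i) = bond f i (k - i) \<circ> bond f k (m - k)"
    using bond_add[of f i "k - i" "m - k"] assms by simp
  then show ?thesis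
    using bond_in[of f X _ k "m - k"] assms by auto
qed

text \<open>Surjectivity lets \<open>u\<close> be lifted one level at a time by dependent choice;
  the coordinates below \<open>i\<close> are forced by pushing down. It serves both for vertex sets
  and for the stable images of an inverse sequence.\<close>

lemma thread_through:
  assumes S: "\<And>i. f i ` S (Suc i) = S i" and u: "u \<in> S i"
  obtains x where "\<forall>j. x j \<in> S j" "\<forall>j. x j = f j (x (Suc j))" "x i = u"
proof -
  have "\<exists>y. \<forall>n. (y n \<in> S (i + n) \<and> (n = 0 \<longrightarrow> y n = u)) \<and> f (i + n) (y (Suc n)) = y n"
  proof (rule dependent_nat_choice)
    show "\<exists>x. x \<in> S (i + 0) \<and> (0 = (0::nat) \<longrightarrow> x = u)" using u by simp
  next
    fix x n assume "x \<in> S (i + n) \<and> (n = 0 \<longrightarrow> x = u)"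
    then have "x \<in> f (i + n) ` S (Suc (i + n))" using S by simp
    then show "\<exists>y. (y \<in> S (i + Suc n) \<and> (Suc n = 0 \<longrightarrow> y = u)) \<and> f (i + n) y = x"
      by auto
  qed
  then obtain y where y: "\<And>n. y n \<in> S (i + n)" "y 0 = u" "\<And>n. f (i + n) (y (Suc n)) = y n"
    by auto
  have u': "bond f i n (y n) = u" for n
    by (induction n) (auto simp: y)
  \<comment> \<open>\<open>y j\<close> lies in level \<open>i + j\<close>, so \<open>i\<close>
    bonding maps bring it to level \<open>j\<close>. One formula thereby covers the levels below and
    above \<open>i\<close>.\<close>
  define x where "x j = bond f j i (y j)" for j
  have "x j = f j (x (Suc j))" for j
    unfolding x_def bond_Suc'[symmetric] using y(3)[of j] by (simp add: add.commute)
  moreover have "x j \<in> S j" for j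
    unfolding x_def using bond_in[of f S "y j" j i] S y(1)[of j] by (simp add: add.commute)
  ultimately show ?thesis
    using that[of x] u'[of i] unfolding x_def by blast
qed

text \<open>The sets \<open>S i\<close> of elements that lift to every higher level have surjective
  bonding maps: under the Mittag-Leffler condition, lifting to one sufficiently high level already
  gives lifting to all. So \<open>thread_through\<close> applies to them.\<close>

lemma mittag_leffler_thread:
  assumes f: "\<And>i. f i ` X (Suc i) \<subseteq> X i" and ml: "mittag_leffler X f"
    and u: "\<And>m. m \<ge> i \<Longrightarrow> u \<in> bond f i (m - i) ` X m"
  obtains x where "\<forall>j. x j \<in> X j" "\<forall>j. x j = f j (x (Suc j))" "x i = u"
proof -
  define S where "S i = (\<Inter>m\<in>{i..}. bond f i (m - i) ` X m)" for i
  have "f i ` S (Suc i) = S i" for i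
  proof (intro equalityI subsetI)
    fix v assume "v \<in> f i ` S (Suc i)"
    then obtain w where w: "w \<in> S (Suc i)" "v = f i w" by auto
    have *: "v \<in> bond f i (m - i) ` X m" if m: "m \<ge> Suc i" for m
    proof -
      obtain t where t: "t \<in> X m" "w = bond f (Suc i) (m - Suc i) t"
        using w(1) m by (auto simp: S_def)
      have "v = bond f i (m - i) t"
        using m bond_Suc'[of f i "m - Suc i" t] w(2) t(2) by (simp add: Suc_diff_Suc)
      then show ?thesis using t(1) by blast
    qed
    have **: "v \<in> bond f i (i - i) ` X i"
      using *[of "Suc i"] bond_image_antimono[of f X i i "Suc i", OF f] by auto
    have "v \<in> bond f i (m - i) ` X m" if "m \<ge> i" for m
      by (cases "m = i") (use * ** that in auto)
    then show "v \<in> S i" by (simp add: S_def)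
  next
    fix v assume v: "v \<in> S i"
    \<comment> \<open>From level \<open>k\<close> on, the images in level \<open>Suc i\<close> are
      constant. Hence a lift of \<open>v\<close> to level \<open>k\<close>, projected to level
      \<open>Suc i\<close>, is a preimage of \<open>v\<close> lying in
      \<open>S (Suc i)\<close>.\<close>
    obtain k where k: "k \<ge> Suc i"
      "\<And>m. m \<ge> k \<Longrightarrow> bond f (Suc i) (m - Suc i) ` X m = bond f (Suc i) (k - Suc i) ` X k"
      using ml unfolding mittag_leffler_def by meson
    obtain t where t: "t \<in> X k" "v = bond f i (k - i) t"
      using v k(1) unfolding S_def by force
    define w where "w = bond f (Suc i) (k - Suc i) t"
    have "w \<in> bond f (Suc i) (m - Suc i) ` X m" if "m \<ge> Suc i" for m
    proof (cases "m \<ge> k")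
      case True
      then show ?thesis using k(2)[OF True] t(1) w_def by auto
    next
      case False
      then show ?thesis
        using bond_image_antimono[of f X "Suc i" m k, OF f] that t(1) w_def by auto
    qed
    then have "w \<in> S (Suc i)" by (auto simp: S_def)
    moreover have "v = f i w"
      using k(1) bond_Suc'[of f i "k - Suc i" t] t(2) by (simp add: Suc_diff_Suc w_def)
    ultimately show "v \<in> f i ` S (Suc i)" by blast
  qed
  moreover have "u \<in> S i" using u by (auto simp: S_def)
  ultimately obtain x where x: "\<forall>j. x j \<in> S j" "\<forall>j. x j = f j (x (Suc j))" "x i = u"
    by (rule thread_through)
  have "x j \<in> X j" for j
    using x(1)[rule_format, of j] by (force simp: S_def)
  with x that show ?thesis by blast
qed

section \<open>The limit space\<close>

lemma limit_verts_iff: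
  "x \<in> limit_verts G \<phi> \<longleftrightarrow> (\<forall>i. x i \<in> pverts (G i)) \<and> (\<forall>i. x i = \<phi> i (x (Suc i)))"
  unfolding limit_verts_def Pi_iff by blast

lemma limit_vertsD:
  assumes "x \<in> limit_verts G \<phi>"
  shows "x i \<in> pverts (G i)" "\<forall>i. x i = \<phi> i (x (Suc i))"
  using limit_verts_iff[THEN iffD1, OF assms] by (rule conjunct1[THEN spec], rule conjunct2)

lemma topspace_limit_topology [simp]: "topspace (limit_topology G \<phi>) = limit_verts G \<phi>"
proof -
  have "limit_verts G \<phi> \<subseteq> (\<Pi>\<^sub>E i\<in>UNIV. pverts (G i))"
    using limit_vertsD(1) by fastforce
  then show ?thesis by (auto simp: limit_topology_def)
qed

lemma openin_cylinder: "openin (limit_topology G \<phi>) {x \<in> limit_verts G \<phi>. x n = a}"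
proof -
  have "continuous_map (limit_topology G \<phi>) (discrete_topology (pverts (G n))) (\<lambda>x. x n)"
    unfolding limit_topology_def
    by (intro continuous_map_from_subtopology continuous_map_product_projection) simp
  from openin_continuous_map_preimage[OF this, of "{a} \<inter> pverts (G n)"]
  have "openin (limit_topology G \<phi>) {x \<in> limit_verts G \<phi>. x n = a \<and> x n \<in> pverts (G n)}"
    by (simp add: conj_commute)
  moreover have "{x \<in> limit_verts G \<phi>. x n = a \<and> x n \<in> pverts (G n)} = {x \<in> limit_verts G \<phi>. x n = a}"
    using limit_vertsD(1) by fast
  ultimately show ?thesis by simp
qed

lemma limit_verts_bond:
  assumes "x \<in> limit_verts G \<phi>" "i \<le> k"
  shows "bond \<phi> i (k - i) (x k) = x i"
proof -
  have "\<forall>j. x j = \<phi> j (x (Suc j))" using assms(1) unfolding limit_verts_iff by blast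
  from bond_thread_le[of x \<phi>, OF this assms(2)] show ?thesis .
qed

text \<open>Coordinate \<open>n\<close> determines all earlier ones through the bonding maps, so a
  single coordinate can stand for finitely many.\<close>

lemma limit_verts_coord_eq:
  assumes "x \<in> limit_verts G \<phi>" "y \<in> limit_verts G \<phi>" "x n = y n" "m \<le> n"
  shows "x m = y m"
proof -
  have "x m = bond \<phi> m (n - m) (y n)"
    using limit_verts_bond[OF assms(1,4)] by (simp only: assms(3))
  also have "\<dots> = y m" by (rule limit_verts_bond[OF assms(2,4)])
  finally show ?thesis .
qed

text \<open>A basic open set of the product constrains only finitely many coordinates, and fixing
  one coordinate at or beyond the last of these fixes them all.\<close>

lemma cylinder_neighbourhood:
  assumes "openin (limit_topology G \<phi>) U" "x \<in> U"
  obtains n where "{y \<in> limit_verts G \<phi>. y n = x n} \<subseteq> U"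
proof -
  obtain T where T: "openin (product_topology (\<lambda>i. discrete_topology (pverts (G i))) UNIV) T"
    "U = T \<inter> limit_verts G \<phi>"
    using assms(1) unfolding limit_topology_def openin_subtopology by blast
  then have "x \<in> T" "x \<in> limit_verts G \<phi>" using assms(2) by simp_all
  obtain A where A: "finite {i. A i \<noteq> pverts (G i)}" "x \<in> Pi\<^sub>E UNIV A" "Pi\<^sub>E UNIV A \<subseteq> T"
    using T(1)[unfolded openin_product_topology_alt, THEN bspec, OF \<open>x \<in> T\<close>] by (simp, blast)
  obtain N where N: "\<And>i. A i \<noteq> pverts (G i) \<Longrightarrow> i \<le> N"
    using A(1) finite_nat_set_iff_bounded_le by auto
  have "y \<in> U" if y: "y \<in> limit_verts G \<phi>" "y N = x N" for y
  proof -
    have "y i \<in> A i" for i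
    proof (cases "A i = pverts (G i)")
      case True
      then show ?thesis using limit_vertsD(1)[OF y(1)] by simp
    next
      case False
      then show ?thesis
        using limit_verts_coord_eq[OF y(1) \<open>x \<in> limit_verts G \<phi>\<close> y(2) N] A(2) by auto
    qed
    then show ?thesis using A(3) T(2) y(1) by auto
  qed
  then show ?thesis using that by blast
qed

section \<open>Lifting, successors and compactness in a graph cover\<close>

context
  fixes G :: "nat \<Rightarrow> 'a pair_pre_digraph" and \<phi> :: "nat \<Rightarrow> 'a \<Rightarrow> 'a"
  assumes cover: "graph_cover G \<phi>"
begin

lemma finite_pverts: "finite (pverts (G i))"
  using cover pair_fin_digraph.pair_finite_verts
  by (auto simp: graph_cover_def finite_graph_def)

lemma parc_in_pverts: "(u, v) \<in> parcs (G i) \<Longrightarrow> u \<in> pverts (G i) \<and> v \<in> pverts (G i)"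
  using cover pair_wf_digraph.in_arcsD1 pair_wf_digraph.in_arcsD2
  by (metis graph_cover_def finite_graph_def pair_fin_digraph.axioms(1))

lemma parc_ex: "u \<in> pverts (G i) \<Longrightarrow> \<exists>v. (u, v) \<in> parcs (G i)"
  using cover by (fastforce simp: graph_cover_def finite_graph_def)

lemma hom_parc: "(u, v) \<in> parcs (G (Suc i)) \<Longrightarrow> (\<phi> i u, \<phi> i v) \<in> parcs (G i)"
  using cover by (auto simp: graph_cover_def graph_hom_def)

lemma hom_eq: "(u, v) \<in> parcs (G (Suc i)) \<Longrightarrow> (u, v') \<in> parcs (G (Suc i)) \<Longrightarrow> \<phi> i v = \<phi> i v'"
  using cover unfolding graph_cover_def plus_directional_def by blast

text \<open>Every vertex begins an edge, so surjectivity on edges yields surjectivity on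
  vertices.\<close>

lemma hom_image_pverts: "\<phi> i ` pverts (G (Suc i)) = pverts (G i)"
proof
  show "\<phi> i ` pverts (G (Suc i)) \<subseteq> pverts (G i)"
    using cover by (auto simp: graph_cover_def graph_hom_def)
  have "map_prod (\<phi> i) (\<phi> i) ` parcs (G (Suc i)) = parcs (G i)"
    using cover by (auto simp: graph_cover_def edge_surjective_def)
  then show "pverts (G i) \<subseteq> \<phi> i ` pverts (G (Suc i))"
    using parc_ex[of _ i] parc_in_pverts[of _ _ "Suc i"] by fastforce
qed

lemma limit_verts_through:
  assumes "a \<in> pverts (G k)"
  obtains x where "x \<in> limit_verts G \<phi>" "x k = a"
proof -
  obtain x where "\<forall>j. x j \<in> pverts (G j)" "\<forall>j. x j = \<phi> j (x (Suc j))" "x k = a"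
    by (rule thread_through[of \<phi> "\<lambda>i. pverts (G i)", OF hom_image_pverts assms])
  then show ?thesis using that limit_verts_iff by blast
qed

lemma limit_action_nonempty:
  assumes x: "x \<in> limit_verts G \<phi>"
  obtains y where "y \<in> limit_action G \<phi> x"
proof -
  have "\<exists>v. (x i, v) \<in> parcs (G i)" for i
    using parc_ex limit_vertsD(1)[OF x] by blast
  then obtain v where v: "\<And>i. (x i, v i) \<in> parcs (G i)" by metis
  \<comment> \<open>The levelwise successors \<open>v i\<close> need not be compatible. By
    +directionality \<open>\<phi> i (v (Suc i))\<close> does not depend on the choice of
    \<open>v (Suc i)\<close>, so the family moved down by one level is a thread.\<close>
  define y where "y i = \<phi> i (v (Suc i))" for i
  have e: "(x i, y i) \<in> parcs (G i)" for i
    using hom_parc[OF v[of "Suc i"]] limit_vertsD(2)[OF x] unfolding y_def by metis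
  have "y i = \<phi> i (y (Suc i))" for i
    using hom_eq[OF v e] unfolding y_def by blast
  then have "y \<in> limit_verts G \<phi>"
    using e parc_in_pverts unfolding limit_verts_iff by blast
  then have "y \<in> limit_action G \<phi> x"
    using x e by (auto simp: limit_action_def limit_edges_def)
  then show ?thesis by (rule that)
qed

lemma walk_map_infinite_walks: "walk_map (\<phi> i) ` infinite_walks (G (Suc i)) \<subseteq> infinite_walks (G i)"
  using hom_parc hom_image_pverts by (fastforce simp: infinite_walks_def walk_map_def)

lemma infinite_walksI: "(\<And>j. (u j, u (Suc j)) \<in> parcs (G i)) \<Longrightarrow> u \<in> infinite_walks (G i)"
  using parc_in_pverts by (auto simp: infinite_walks_def)

text \<open>The limit is an intersection of equalizers, hence closed in a product of finite discrete
  spaces, which is compact by Tychonoff.\<close>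

lemma compact_limit: "compact_space (limit_topology G \<phi>)"
proof -
  let ?P = "product_topology (\<lambda>i. discrete_topology (pverts (G i))) UNIV"
  have "compact_space ?P"
    by (simp add: compact_space_product_topology compact_space_discrete_topology finite_pverts)
  moreover have "closedin ?P (limit_verts G \<phi>)"
  proof -
    have "closedin ?P {x \<in> topspace ?P. x i = \<phi> i (x (Suc i))}" for i
    proof (rule closedin_continuous_maps_eq)
      show "Hausdorff_space (discrete_topology (pverts (G i)))"
        by (simp add: Hausdorff_space_discrete_topology)
      show "continuous_map ?P (discrete_topology (pverts (G i))) (\<lambda>x. x i)"
        by (rule continuous_map_product_projection) simp
      have "continuous_map ?P (discrete_topology (pverts (G i))) (\<phi> i \<circ> (\<lambda>x. x (Suc i)))"
        by (rule continuous_map_compose[OF continuous_map_product_projection])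
          (use hom_image_pverts in auto)
      then show "continuous_map ?P (discrete_topology (pverts (G i))) (\<lambda>x. \<phi> i (x (Suc i)))"
        by (simp add: o_def)
    qed
    then have "closedin ?P (\<Inter>i. {x \<in> topspace ?P. x i = \<phi> i (x (Suc i))})"
      by (intro closedin_Inter) auto
    moreover have "(\<Inter>i. {x \<in> topspace ?P. x i = \<phi> i (x (Suc i))}) = limit_verts G \<phi>"
      unfolding set_eq_iff limit_verts_iff topspace_product_topology PiE_UNIV_domain
        topspace_discrete_topology Pi_iff by blast
    ultimately show ?thesis by simp
  qed
  ultimately show ?thesis
    unfolding limit_topology_def
    by (simp add: closedin_compact_space compact_space_subtopology)
qed

text \<open>An analogue of the Lebesgue number: finitely many cylinders inside members of
  \<open>\<U>\<close> cover the limit, and any level beyond all of theirs works uniformly. The bound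
  \<open>i \<le> n\<close> lets a minimal level be prescribed.\<close>

lemma cylinders_refine_cover:
  assumes U: "finite_open_cover (limit_topology G \<phi>) \<U>"
  obtains n where "i \<le> n"
    "\<forall>x\<in>limit_verts G \<phi>. \<exists>U\<in>\<U>. {y \<in> limit_verts G \<phi>. y n = x n} \<subseteq> U"
proof -
  let ?L = "limit_verts G \<phi>"
  define C where "C n x = {y \<in> ?L. y n = x n}" for n :: nat and x :: "nat \<Rightarrow> 'a"
  have "\<exists>n. \<exists>U\<in>\<U>. C n x \<subseteq> U" if x: "x \<in> ?L" for x
  proof -
    obtain U where "U \<in> \<U>" "x \<in> U" "openin (limit_topology G \<phi>) U"
      using U x unfolding finite_open_cover_def by auto
    then show ?thesis using cylinder_neighbourhood[of G \<phi> U x] C_def by metis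
  qed
  then obtain l where l: "\<And>x. x \<in> ?L \<Longrightarrow> \<exists>U\<in>\<U>. C (l x) x \<subseteq> U" by metis
  have "\<forall>V\<in>(\<lambda>x. C (l x) x) ` ?L. openin (limit_topology G \<phi>) V"
    by (simp add: C_def openin_cylinder)
  moreover have "?L \<subseteq> \<Union>((\<lambda>x. C (l x) x) ` ?L)"
    by (auto simp: C_def)
  ultimately obtain \<F> where F: "finite \<F>" "\<F> \<subseteq> (\<lambda>x. C (l x) x) ` ?L" "?L \<subseteq> \<Union>\<F>"
    using compact_limit unfolding compact_space_alt topspace_limit_topology by meson
  then obtain P where P: "P \<subseteq> ?L" "finite P" "\<F> = (\<lambda>x. C (l x) x) ` P"
    by (meson finite_subset_image)
  obtain n where n: "i \<le> n" "\<And>p. p \<in> P \<Longrightarrow> l p \<le> n"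
    using finite_nat_set_iff_bounded_le[of "insert i (l ` P)"] P(2) by auto
  have "\<exists>U\<in>\<U>. {y \<in> ?L. y n = x n} \<subseteq> U" if x: "x \<in> ?L" for x
  proof -
    obtain p where p: "p \<in> P" "x (l p) = p (l p)"
      using F(3) P(3) x by (auto simp: C_def)
    have "{y \<in> ?L. y n = x n} \<subseteq> C (l p) p"
      using limit_verts_coord_eq[OF _ x _ n(2)[OF p(1)]] p(2) by (auto simp: C_def)
    then show ?thesis using l[of p] P(1) p(1) by blast
  qed
  with n(1) that show ?thesis by blast
qed

lemma finite_open_cover_cylinders:
  "finite_open_cover (limit_topology G \<phi>) ((\<lambda>a. {x \<in> limit_verts G \<phi>. x n = a}) ` pverts (G n))"
  unfolding finite_open_cover_def
  using finite_pverts openin_cylinder[of G \<phi>] limit_vertsD(1)[of _ G \<phi>] by auto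

section \<open>Walks and orbits\<close>

lemma bond_walk_map: "bond (\<lambda>i. walk_map (\<phi> i)) i k w = walk_map (bond \<phi> i k) w"
  by (induction k arbitrary: w) (auto simp: walk_map_def)

lemma orbit_walk:
  assumes "\<forall>j. z (Suc j) \<in> limit_action G \<phi> (z j)"
  shows "(\<lambda>j. z j i) \<in> infinite_walks (G i)"
  using assms by (intro infinite_walksI) (auto simp: limit_action_def limit_edges_def)

lemma mittag_leffler_if_shadowing:
  assumes sh: "shadowing_property (limit_topology G \<phi>) (limit_action G \<phi>)"
  shows "mittag_leffler (\<lambda>i. infinite_walks (G i)) (\<lambda>i. walk_map (\<phi> i))"
  unfolding mittag_leffler_def
proof
  let ?L = "limit_verts G \<phi>" and ?f = "\<lambda>i. walk_map (\<phi> i)" and ?X = "\<lambda>i. infinite_walks (G i)"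
  fix i
  \<comment> \<open>For the cover by level-\<open>i\<close> cylinders, shadowing amounts to equality
    of the \<open>i\<close>-th coordinates.\<close>
  obtain \<V> where V: "finite_open_cover (limit_topology G \<phi>) \<V>"
    and shad: "\<And>x. pseudo_orbit (limit_topology G \<phi>) (limit_action G \<phi>) \<V> x \<Longrightarrow>
      \<exists>z. (\<forall>j. z j \<in> ?L) \<and> (\<forall>j. z (Suc j) \<in> limit_action G \<phi> (z j)) \<and> (\<forall>j. x j i = z j i)"
    using sh[unfolded shadowing_property_def, rule_format, OF finite_open_cover_cylinders[of i]]
    by simp (metis (no_types, lifting))
  obtain k where k: "i \<le> k" "\<forall>x\<in>?L. \<exists>U\<in>\<V>. {y \<in> ?L. y k = x k} \<subseteq> U"
    by (rule cylinders_refine_cover[OF V, where i = i])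
  \<comment> \<open>+Directionality costs one level, hence \<open>Suc k\<close> and not
    \<open>k\<close>: two successors of a vertex in \<open>G (Suc k)\<close> are only known to agree
    after applying \<open>\<phi> k\<close>.\<close>
  have lift: "bond ?f i (Suc k - i) w \<in> bond ?f i (m - i) ` ?X m"
    if w: "w \<in> ?X (Suc k)" and m: "m \<ge> i" for w m
  proof -
    have "\<exists>x. x \<in> ?L \<and> x (Suc k) = w j" for j
    proof -
      have "w j \<in> pverts (G (Suc k))" using w by (auto simp: infinite_walks_def)
      then show ?thesis using limit_verts_through by blast
    qed
    then obtain x where x: "\<And>j. x j \<in> ?L" "\<And>j. x j (Suc k) = w j" by metis
    have "\<exists>W\<in>\<V>. limit_action G \<phi> (x j) \<inter> W \<noteq> {} \<and> x (Suc j) \<in> W" for j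
    proof -
      obtain W where W: "W \<in> \<V>" "{y \<in> ?L. y k = x (Suc j) k} \<subseteq> W"
        using k(2) x(1) by blast
      obtain y where y: "y \<in> limit_action G \<phi> (x j)"
        using limit_action_nonempty[OF x(1)] by blast
      then have y': "y \<in> ?L" "(w j, y (Suc k)) \<in> parcs (G (Suc k))"
        using x(2)[of j] by (auto simp: limit_action_def limit_edges_def) metis
      \<comment> \<open>The true image \<open>y\<close> and the lifted next vertex
        \<open>x (Suc j)\<close> both give successors of \<open>w j\<close> in level
        \<open>Suc k\<close>. They therefore agree in level \<open>k\<close> and share the member
        \<open>W\<close>.\<close>
      have "(w j, w (Suc j)) \<in> parcs (G (Suc k))"
        using w by (auto simp: infinite_walks_def)
      then have "\<phi> k (y (Suc k)) = \<phi> k (w (Suc j))"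
        using hom_eq y'(2) by blast
      then have "y k = x (Suc j) k"
        using limit_vertsD(2)[OF y'(1), THEN spec, of k]
            limit_vertsD(2)[OF x(1), THEN spec, of "Suc j" k] x(2)[of "Suc j"] by metis
      then show ?thesis using W y y'(1) x(1) by blast
    qed
    then have "pseudo_orbit (limit_topology G \<phi>) (limit_action G \<phi>) \<V> x"
      using x(1) by (auto simp: pseudo_orbit_def)
    then obtain z where z: "\<And>j. z j \<in> ?L" "\<forall>j. z (Suc j) \<in> limit_action G \<phi> (z j)"
      "\<And>j. x j i = z j i"
      using shad by metis
    \<comment> \<open>The two sides are \<open>x j i\<close> and \<open>z j i\<close>, so the
      level-\<open>m\<close> coordinates of the shadowing orbit form the required lift.\<close>
    have "bond \<phi> i (Suc k - i) (w j) = bond \<phi> i (m - i) (z j m)" for j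
      using limit_verts_bond[OF x(1), of i "Suc k" j] x(2)[of j] k(1)
        limit_verts_bond[OF z(1) m, of j] z(3)[of j] by simp
    then have "bond ?f i (Suc k - i) w = bond ?f i (m - i) (\<lambda>j. z j m)"
      unfolding bond_walk_map by (simp add: walk_map_def)
    then show ?thesis using orbit_walk[OF z(2)] by blast
  qed
  have "bond ?f i (m - i) ` ?X m = bond ?f i (Suc k - i) ` ?X (Suc k)" if "m \<ge> Suc k" for m
  proof
    show "bond ?f i (m - i) ` ?X m \<subseteq> bond ?f i (Suc k - i) ` ?X (Suc k)"
      using bond_image_antimono[of ?f ?X i "Suc k" m, OF walk_map_infinite_walks] k(1) that by simp
    show "bond ?f i (Suc k - i) ` ?X (Suc k) \<subseteq> bond ?f i (m - i) ` ?X m"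
      by (intro image_subsetI lift) (use that k(1) in simp_all)
  qed
  then show "\<exists>k\<ge>i. \<forall>m\<ge>k. bond ?f i (m - i) ` ?X m = bond ?f i (k - i) ` ?X k"
    using le_SucI[OF k(1)] by blast
qed

lemma shadowing_if_mittag_leffler:
  assumes ml: "mittag_leffler (\<lambda>i. infinite_walks (G i)) (\<lambda>i. walk_map (\<phi> i))"
  shows "shadowing_property (limit_topology G \<phi>) (limit_action G \<phi>)"
  unfolding shadowing_property_def topspace_limit_topology
proof (intro allI impI)
  let ?L = "limit_verts G \<phi>" and ?f = "\<lambda>i. walk_map (\<phi> i)" and ?X = "\<lambda>i. infinite_walks (G i)"
  fix \<U> assume "finite_open_cover (limit_topology G \<phi>) \<U>"
  then obtain i where "0 \<le> i" and i: "\<forall>x\<in>?L. \<exists>U\<in>\<U>. {y \<in> ?L. y i = x i} \<subseteq> U"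
    by (rule cylinders_refine_cover[where i = 0])
  obtain k where k: "k \<ge> i" "\<And>m. m \<ge> k \<Longrightarrow> bond ?f i (m - i) ` ?X m = bond ?f i (k - i) ` ?X k"
    using ml unfolding mittag_leffler_def by meson
  \<comment> \<open>By the choice of \<open>k\<close>, a walk of \<open>G i\<close> that comes from
    level \<open>k\<close> comes from every higher level; this is why level-\<open>k\<close>
    cylinders are fine enough.\<close>
  let ?V = "(\<lambda>a. {x \<in> ?L. x k = a}) ` pverts (G k)"
  have "\<exists>z. (\<forall>j. z j \<in> ?L) \<and> (\<forall>j. z (Suc j) \<in> limit_action G \<phi> (z j)) \<and>
      (\<forall>j. \<exists>U\<in>\<U>. x j \<in> U \<and> z j \<in> U)"
    if x: "pseudo_orbit (limit_topology G \<phi>) (limit_action G \<phi>) ?V x" for x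
  proof -
    have xL: "x j \<in> ?L" for j using x by (auto simp: pseudo_orbit_def)
    have "(x j k, x (Suc j) k) \<in> parcs (G k)" for j
    proof -
      obtain y where "y \<in> limit_action G \<phi> (x j)" "y k = x (Suc j) k"
        using x unfolding pseudo_orbit_def by fastforce
      then show ?thesis by (auto simp: limit_action_def limit_edges_def) metis
    qed
    then have w: "(\<lambda>j. x j k) \<in> ?X k" by (rule infinite_walksI)
    define u where "u = bond ?f i (k - i) (\<lambda>j. x j k)"
    have u: "u j = x j i" for j
      unfolding u_def bond_walk_map walk_map_def
      using limit_verts_bond[OF xL k(1)] by simp
    have "u \<in> bond ?f i (m - i) ` ?X m" if "m \<ge> i" for m
    proof (cases "m \<ge> k")
      case True
      then show ?thesis using k(2)[OF True] w u_def by auto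
    next
      case False
      then show ?thesis
        using bond_image_antimono[of ?f ?X i m k, OF walk_map_infinite_walks] that w u_def by auto
    qed
    then obtain t where t: "\<forall>j. t j \<in> ?X j" "\<forall>j. t j = ?f j (t (Suc j))" "t i = u"
      using mittag_leffler_thread[of ?f ?X i u, OF walk_map_infinite_walks ml] by metis
    \<comment> \<open>The thread of walks is transposed into an orbit: \<open>t n\<close> is a walk
      in level \<open>n\<close>, while \<open>z j\<close> collects the vertices of all levels at
      time \<open>j\<close>.\<close>
    define z where "z j = (\<lambda>n. t n j)" for j
    have zL: "z j \<in> ?L" for j
    proof -
      have "z j n = \<phi> n (z j (Suc n))" for n
        using t(2) unfolding walk_map_def z_def by metis
      moreover have "z j n \<in> pverts (G n)" for n
        using t(1) by (auto simp: z_def infinite_walks_def)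
      ultimately show ?thesis unfolding limit_verts_iff by blast
    qed
    moreover have "z (Suc j) \<in> limit_action G \<phi> (z j)" for j
      using zL t(1) by (auto simp: limit_action_def limit_edges_def z_def infinite_walks_def)
    \<comment> \<open>Since \<open>t i = u\<close>, the points \<open>x j\<close> and
      \<open>z j\<close> have the same \<open>i\<close>-th coordinate, and their common cylinder
      lies in one member of \<open>\<U>\<close>.\<close>
    moreover have "\<exists>U\<in>\<U>. x j \<in> U \<and> z j \<in> U" for j
      using bspec[OF i xL[of j]] xL[of j] zL[of j] t(3) u[of j] by (auto simp: z_def)
    ultimately show ?thesis by blast
  qed
  then show "\<exists>\<V>. finite_open_cover (limit_topology G \<phi>) \<V> \<and>
      (\<forall>x. pseudo_orbit (limit_topology G \<phi>) (limit_action G \<phi>) \<V> x \<longrightarrow>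
        (\<exists>z. (\<forall>j. z j \<in> ?L) \<and> (\<forall>j. z (Suc j) \<in> limit_action G \<phi> (z j)) \<and>
          (\<forall>j. \<exists>U\<in>\<U>. x j \<in> U \<and> z j \<in> U)))"
    using finite_open_cover_cylinders by blast
qed

end

theorem theorem6p12:
  fixes G :: "nat \<Rightarrow> 'a pair_pre_digraph" and \<phi> :: "nat \<Rightarrow> 'a \<Rightarrow> 'a"
  assumes "graph_cover G \<phi>"
  shows "shadowing_property (limit_topology G \<phi>) (limit_action G \<phi>) \<longleftrightarrow>
         mittag_leffler (\<lambda>i. infinite_walks (G i)) (\<lambda>i. walk_map (\<phi> i))"
  using mittag_leffler_if_shadowing[OF assms] shadowing_if_mittag_leffler[OF assms] by blast

end
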